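(* Let $(X,\bot\subseteq\mathbb{N}[X+X])$ be an implication frame, and let $[\![A]\!]=\langle a_+,a_-\rangle$ and $[\![B]\!]=\langle b_+,b_-\rangle$ be pairs of roles. Then the quantale-theoretic clauses $$\neg A:=\langle a_-,a_+\rangle,\quad A\otimes B:=\langle a_+\otimes b_+,\ a_-\wp b_-\rangle,\quad A\oplus B:=\langle a_+\vee b_+,\ a_-\wedge b_-\rangle,$$ $$A\wp B:=\langle a_+\wp b_+,\ a_-\otimes b_-\rangle,\quad A\,\&\,B:=\langle a_+\wedge b_+,\ a_-\vee b_-\rangle,$$ (with operations in the Girard quantale $F^{\otimes\neg\oplus}(X,\bot)$) coincide with the implication-space clauses $$\neg A:=\langle a_-,a_+\rangle,\quad A\otimes B:=\langle a_+\sqcup b_+,\ (a_-^\bot\sqcup b_-^\bot)^\bot\rangle,\quad A\oplus B:=\langle a_+\sqcap b_+,\ (a_-^\bot\sqcap b_-^\bot)^\bot\rangle,$$ $$A\wp B:=\neg(\neg A\otimes\neg B),\quad A\,\&\,B:=\neg(\neg A\oplus\neg B)$$ (with $(-)^\bot$ the range of subjunctive robustness).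
   Context: $\mathbb{N}[X+X]\cong\mathbb{N}[X]\times\mathbb{N}[X]$ is the commutative monoid of finite multisets (under multiset union, written $+$). An implication frame is a set $X$ with a subset $\bot\subseteq\mathbb{N}[X+X]$. For $A\subseteq\mathbb{N}[X+X]$, the range of subjunctive robustness is $\mathrm{RSR}(A)=A^\bot:=\{p\mid\forall a\in A\colon p+a\in\bot\}$. A role is an element of the image $\mathbb{R}$ of $\mathrm{RSR}\colon\mathcal{P}[\mathbb{N}[X+X]]\to\mathcal{P}[\mathbb{N}[X+X]]$. Implication-space operations on roles: $A\sqcap B:=(A\cup B)^{\bot\bot}$ and $A\sqcup B:=\{a+b\mid a\in A,\ b\in B\}^{\bot\bot}$. The Girard quantale $F^{\otimes\neg\oplus}(X,\bot)$ has as elements the subsets $A\subseteq\mathbb{N}[X+X]$ with $A^{\bot\bot}=A$ (these are exactly the roles), ordered by inclusion, with $A\otimes B:=\{a+b\mid a\in A,b\in B\}^{\bot\bot}$, joins $A\vee B=(A\cup B)^{\bot\bot}$, and dualizing element $\bot$; $\wedge$ denotes binary meet in this lattice, and $x\wp y:=(x^\bot\otimes y^\bot)^\bot$, where in the quantale $x^\bot$ is the largest $c$ with $c\otimes x\subseteq\bot$. *)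

theory Defs
  imports "HOL-Algebra.Lattice" "HOL-Library.Multiset"
begin

text \<open>
  The set \<open>X\<close> is a carrier set in a type, so that it may be empty.  The free commutative monoid on
  the disjoint union \<open>X + X\<close> consists of the finite multisets with elements in \<open>X <+> X\<close>.
\<close>

definition free_monoid :: "'x set \<Rightarrow> ('x + 'x) multiset set"
  where "free_monoid X = {p. set_mset p \<subseteq> X <+> X}"

definition implication_frame :: "'x set \<Rightarrow> ('x + 'x) multiset set \<Rightarrow> bool"
  where "implication_frame X bt \<longleftrightarrow> bt \<subseteq> free_monoid X"

definition RSR :: "'x set \<Rightarrow> ('x + 'x) multiset set \<Rightarrow> ('x + 'x) multiset set \<Rightarrow> ('x + 'x) multiset set"
  where "RSR X bt A = {p \<in> free_monoid X. \<forall>a\<in>A. p + a \<in> bt}"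

abbreviation RSR2 :: "'x set \<Rightarrow> ('x + 'x) multiset set \<Rightarrow> ('x + 'x) multiset set \<Rightarrow> ('x + 'x) multiset set"
  where "RSR2 X bt A \<equiv> RSR X bt (RSR X bt A)"

definition roles :: "'x set \<Rightarrow> ('x + 'x) multiset set \<Rightarrow> ('x + 'x) multiset set set"
  where "roles X bt = RSR X bt ` Pow (free_monoid X)"

definition msum :: "'m::plus set \<Rightarrow> 'm set \<Rightarrow> 'm set"
  where "msum A B = {a + b | a b. a \<in> A \<and> b \<in> B}"

text \<open>
  Pitfall: the implication-space operations written \<open>\<sqinter>\<close> and \<open>\<squnion>\<close>, here \<open>is_cap\<close> and
  \<open>is_cup\<close>, are not meet and join: for the inclusion order on roles, \<open>is_cap\<close> is the join
  and \<open>is_cup\<close> is the tensor.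
\<close>

definition is_cap ::
    "'x set \<Rightarrow> ('x + 'x) multiset set \<Rightarrow> ('x + 'x) multiset set \<Rightarrow> ('x + 'x) multiset set \<Rightarrow> ('x + 'x) multiset set"
  where "is_cap X bt A B = RSR2 X bt (A \<union> B)"

definition is_cup ::
    "'x set \<Rightarrow> ('x + 'x) multiset set \<Rightarrow> ('x + 'x) multiset set \<Rightarrow> ('x + 'x) multiset set \<Rightarrow> ('x + 'x) multiset set"
  where "is_cup X bt A B = RSR2 X bt (msum A B)"

type_synonym 'x content = "('x + 'x) multiset set \<times> ('x + 'x) multiset set"

definition is_neg :: "'x content \<Rightarrow> 'x content"
  where "is_neg A = (snd A, fst A)"

definition is_tensor :: "'x set \<Rightarrow> ('x + 'x) multiset set \<Rightarrow> 'x content \<Rightarrow> 'x content \<Rightarrow> 'x content"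
  where "is_tensor X bt A B =
    (is_cup X bt (fst A) (fst B),
     RSR X bt (is_cup X bt (RSR X bt (snd A)) (RSR X bt (snd B))))"

definition is_plus :: "'x set \<Rightarrow> ('x + 'x) multiset set \<Rightarrow> 'x content \<Rightarrow> 'x content \<Rightarrow> 'x content"
  where "is_plus X bt A B =
    (is_cap X bt (fst A) (fst B),
     RSR X bt (is_cap X bt (RSR X bt (snd A)) (RSR X bt (snd B))))"

definition is_par :: "'x set \<Rightarrow> ('x + 'x) multiset set \<Rightarrow> 'x content \<Rightarrow> 'x content \<Rightarrow> 'x content"
  where "is_par X bt A B = is_neg (is_tensor X bt (is_neg A) (is_neg B))"

definition is_with :: "'x set \<Rightarrow> ('x + 'x) multiset set \<Rightarrow> 'x content \<Rightarrow> 'x content \<Rightarrow> 'x content"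
  where "is_with X bt A B = is_neg (is_plus X bt (is_neg A) (is_neg B))"

text \<open>
  The data of a quantale with a distinguished dualizing element.  Joins and meets are those of the
  underlying order, i.e. \<^const>\<open>join\<close> and \<^const>\<open>meet\<close>.
\<close>

record 'a quantale = "'a gorder" +
  tensor :: "'a \<Rightarrow> 'a \<Rightarrow> 'a"
  dualizing :: 'a

definition q_dual :: "'a quantale \<Rightarrow> 'a \<Rightarrow> 'a"
  where "q_dual Q x =
    (THE c. greatest Q c {d \<in> carrier Q. tensor Q d x \<sqsubseteq>\<^bsub>Q\<^esub> dualizing Q})"

definition q_par :: "'a quantale \<Rightarrow> 'a \<Rightarrow> 'a \<Rightarrow> 'a"
  where "q_par Q x y = q_dual Q (tensor Q (q_dual Q x) (q_dual Q y))"

definition qt_neg :: "'a \<times> 'a \<Rightarrow> 'a \<times> 'a"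
  where "qt_neg A = (snd A, fst A)"

definition qt_tensor :: "'a quantale \<Rightarrow> 'a \<times> 'a \<Rightarrow> 'a \<times> 'a \<Rightarrow> 'a \<times> 'a"
  where "qt_tensor Q A B = (tensor Q (fst A) (fst B), q_par Q (snd A) (snd B))"

definition qt_plus :: "'a quantale \<Rightarrow> 'a \<times> 'a \<Rightarrow> 'a \<times> 'a \<Rightarrow> 'a \<times> 'a"
  where "qt_plus Q A B = (fst A \<squnion>\<^bsub>Q\<^esub> fst B, snd A \<sqinter>\<^bsub>Q\<^esub> snd B)"

definition qt_par :: "'a quantale \<Rightarrow> 'a \<times> 'a \<Rightarrow> 'a \<times> 'a \<Rightarrow> 'a \<times> 'a"
  where "qt_par Q A B = (q_par Q (fst A) (fst B), tensor Q (snd A) (snd B))"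

definition qt_with :: "'a quantale \<Rightarrow> 'a \<times> 'a \<Rightarrow> 'a \<times> 'a \<Rightarrow> 'a \<times> 'a"
  where "qt_with Q A B = (fst A \<sqinter>\<^bsub>Q\<^esub> fst B, snd A \<squnion>\<^bsub>Q\<^esub> snd B)"

definition girard_quantale ::
    "'x set \<Rightarrow> ('x + 'x) multiset set \<Rightarrow> ('x + 'x) multiset set quantale"
  where "girard_quantale X bt =
    \<lparr> carrier = {A. A \<subseteq> free_monoid X \<and> RSR2 X bt A = A},
      eq = (=),
      le = (\<subseteq>),
      tensor = (\<lambda>A B. RSR2 X bt (msum A B)),
      dualizing = bt \<rparr>"

lemma RSR_antimono: "A \<subseteq> B \<Longrightarrow> RSR X bt B \<subseteq> RSR X bt A"
  by (auto simp: RSR_def)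

lemma RSR_subset: "RSR X bt A \<subseteq> free_monoid X"
  by (auto simp: RSR_def)

lemma subset_RSR2: "A \<subseteq> free_monoid X \<Longrightarrow> A \<subseteq> RSR2 X bt A"
  by (auto simp: RSR_def add.commute)

lemma RSR3: "A \<subseteq> free_monoid X \<Longrightarrow> RSR X bt (RSR2 X bt A) = RSR X bt A"
  by (meson RSR_antimono RSR_subset subset_RSR2 subset_antisym)

lemma carrier_girard_quantale: "carrier (girard_quantale X bt) = roles X bt"
proof -
  have "A \<in> roles X bt" if "A \<subseteq> free_monoid X" "RSR2 X bt A = A" for A
    unfolding roles_def using that RSR_subset by (metis PowI imageI)
  then show ?thesis
    by (auto simp: girard_quantale_def roles_def RSR3 dest: subsetD[OF RSR_subset])
qed

lemma join_girard_quantale: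
  assumes A: "A \<in> carrier (girard_quantale X bt)" and B: "B \<in> carrier (girard_quantale X bt)"
  shows "A \<squnion>\<^bsub>girard_quantale X bt\<^esub> B = RSR2 X bt (A \<union> B)"
proof -
  let ?Q = "girard_quantale X bt"
  have AB: "A \<union> B \<subseteq> free_monoid X" using A B by (auto simp: girard_quantale_def)
  have lub: "least ?Q (RSR2 X bt (A \<union> B)) (Upper ?Q {A, B})"
  proof -
    have "RSR2 X bt (A \<union> B) \<in> Upper ?Q {A, B}"
      using subset_RSR2[OF AB, of bt] RSR_subset RSR3[OF AB]
      by (auto simp: Upper_def girard_quantale_def dest: subsetD[OF RSR_subset])
    moreover have "RSR2 X bt (A \<union> B) \<subseteq> C" if "C \<in> Upper ?Q {A, B}" for C
    proof -
      have "RSR2 X bt C = C" "A \<union> B \<subseteq> C"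
        using that A B by (auto simp: Upper_def girard_quantale_def)
      then show ?thesis by (metis RSR_antimono)
    qed
    ultimately show ?thesis
      by (auto simp: least_def Upper_def girard_quantale_def)
  qed
  have "C = RSR2 X bt (A \<union> B)" if "least ?Q C (Upper ?Q {A, B})" for C
    using that lub unfolding least_def by (auto simp: girard_quantale_def)
  then show ?thesis
    unfolding join_def sup_def using lub by (metis (mono_tags, lifting) someI_ex)
qed

end

theory Submission
  imports Defs
begin

text \<open>
  Since \<open>bt\<close> is the \<open>RSR\<close> of \<open>{0}\<close>, it is itself a role, so a tensor product lies below \<open>bt\<close> iff the
  pointwise sum does, before closure.  Hence the quantale dual of a role is its \<open>RSR\<close>.  Meets are
  intersections, which \<open>RSR\<close> obtains from unions by De Morgan.
\<close>

lemma RSR_Un: "RSR X bt (A \<union> B) = RSR X bt A \<inter> RSR X bt B"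
  by (auto simp: RSR_def)

lemma RSR_mem_roles: "A \<subseteq> free_monoid X \<Longrightarrow> RSR X bt A \<in> roles X bt"
  by (auto simp: roles_def)

lemma roles_subset: "A \<in> roles X bt \<Longrightarrow> A \<subseteq> free_monoid X"
  by (auto simp: roles_def dest: subsetD[OF RSR_subset])

lemma RSR2_role: "A \<in> roles X bt \<Longrightarrow> RSR2 X bt A = A"
  by (auto simp: roles_def RSR3)

lemma msum_subset_free_monoid:
  "A \<subseteq> free_monoid X \<Longrightarrow> B \<subseteq> free_monoid X \<Longrightarrow> msum A B \<subseteq> free_monoid X"
  by (fastforce simp: msum_def free_monoid_def)

text \<open>Residuation: \<open>RSR\<close> is right adjoint to pointwise addition relative to
  \<open>bt\<close>. The assumption on \<open>A\<close> matters because \<open>RSR\<close> only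
  collects elements of the free monoid.\<close>

lemma subset_RSR_iff: "A \<subseteq> free_monoid X \<Longrightarrow> A \<subseteq> RSR X bt B \<longleftrightarrow> msum A B \<subseteq> bt"
  by (fastforce simp: RSR_def msum_def)

lemma RSR_zero: "implication_frame X bt \<Longrightarrow> RSR X bt {{#}} = bt"
  by (auto simp: implication_frame_def RSR_def)

lemma bt_mem_roles: "implication_frame X bt \<Longrightarrow> bt \<in> roles X bt"
  using RSR_mem_roles[of "{{#}}" X bt] by (simp add: RSR_zero free_monoid_def)

lemma RSR2_subset_iff:
  assumes "A \<subseteq> free_monoid X" and "C \<in> roles X bt"
  shows "RSR2 X bt A \<subseteq> C \<longleftrightarrow> A \<subseteq> C"
  using assms by (metis RSR2_role RSR_antimono subset_RSR2 subset_trans)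

lemma tensor_girard_quantale: "tensor (girard_quantale X bt) A B = is_cup X bt A B"
  by (simp add: girard_quantale_def is_cup_def)

text \<open>Lets the outer dual in \<open>q_par\<close> be evaluated, since duals are computed on
  roles only.\<close>

lemma is_cup_mem_roles: "is_cup X bt A B \<in> roles X bt"
  by (simp add: is_cup_def RSR_mem_roles RSR_subset)

lemma q_dual_girard_quantale:
  assumes "implication_frame X bt" and A: "A \<in> roles X bt"
  shows "q_dual (girard_quantale X bt) A = RSR X bt A"
proof -
  let ?Q = "girard_quantale X bt"
  have le: "le ?Q = (\<subseteq>)" and dual: "dualizing ?Q = bt"
    by (simp_all add: girard_quantale_def)
  have "is_cup X bt D A \<subseteq> bt \<longleftrightarrow> D \<subseteq> RSR X bt A" if "D \<in> roles X bt" for D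
    using that assms
    by (simp add: is_cup_def RSR2_subset_iff bt_mem_roles msum_subset_free_monoid
        roles_subset subset_RSR_iff)
  then have set: "{D \<in> carrier ?Q. tensor ?Q D A \<sqsubseteq>\<^bsub>?Q\<^esub> dualizing ?Q}
      = {D \<in> roles X bt. D \<subseteq> RSR X bt A}"
    by (auto simp: le dual tensor_girard_quantale carrier_girard_quantale)
  \<comment> \<open>Being a role, the upper bound \<open>RSR X bt A\<close> belongs to the set it
    bounds, which makes it the unique greatest element and gives the definite description in
    \<open>q_dual\<close> its value.\<close>
  have "RSR X bt A \<in> roles X bt"
    using A by (simp add: RSR_mem_roles roles_subset)
  then have "greatest ?Q C {D \<in> roles X bt. D \<subseteq> RSR X bt A} \<longleftrightarrow> C = RSR X bt A" for C
    by (auto simp: greatest_def le carrier_girard_quantale)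
  then show ?thesis
    unfolding q_dual_def set by simp
qed

lemma q_par_girard_quantale:
  assumes "implication_frame X bt" and "A \<in> roles X bt" and "B \<in> roles X bt"
  shows "q_par (girard_quantale X bt) A B = RSR X bt (is_cup X bt (RSR X bt A) (RSR X bt B))"
  using assms
  by (simp add: q_par_def q_dual_girard_quantale tensor_girard_quantale is_cup_mem_roles)

text \<open>The outer \<open>RSR\<close> absorbs the closure in \<open>is_cap\<close>; De Morgan
  then leaves two double \<open>RSR\<close>s, each of which fixes its role.\<close>

lemma RSR_is_cap:
  assumes "A \<in> roles X bt" and "B \<in> roles X bt"
  shows "RSR X bt (is_cap X bt (RSR X bt A) (RSR X bt B)) = A \<inter> B"
proof -
  have "RSR X bt (is_cap X bt (RSR X bt A) (RSR X bt B)) = RSR X bt (RSR X bt A \<union> RSR X bt B)"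
    by (simp add: is_cap_def RSR3 RSR_subset)
  with assms show ?thesis
    by (simp add: RSR_Un RSR2_role)
qed

lemma Int_mem_roles:
  assumes "A \<in> roles X bt" and "B \<in> roles X bt"
  shows "A \<inter> B \<in> roles X bt"
  \<comment> \<open>Read from right to left, De Morgan exhibits the intersection as a value of
    \<open>RSR\<close>.\<close>
  unfolding RSR_is_cap[OF assms, symmetric] is_cap_def by (intro RSR_mem_roles RSR_subset)

lemma meet_girard_quantale:
  assumes "A \<in> roles X bt" and "B \<in> roles X bt"
  shows "A \<sqinter>\<^bsub>girard_quantale X bt\<^esub> B = A \<inter> B"
proof -
  let ?Q = "girard_quantale X bt"
  have le: "le ?Q = (\<subseteq>)"
    by (simp add: girard_quantale_def)
  have "Lower ?Q {A, B} = {C \<in> roles X bt. C \<subseteq> A \<inter> B}"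
    using assms by (auto simp: Lower_def le carrier_girard_quantale)
  \<comment> \<open>An equivalence rather than mere existence: \<open>inf\<close> is a Hilbert
    choice, so uniqueness is needed too.\<close>
  then have "greatest ?Q C (Lower ?Q {A, B}) \<longleftrightarrow> C = A \<inter> B" for C
    using Int_mem_roles[OF assms] by (auto simp: greatest_def le carrier_girard_quantale)
  then show ?thesis
    by (simp add: meet_def inf_def)
qed

theorem proposition3p2:
  fixes X :: "'x set" and bt :: "('x + 'x) multiset set"
    and ap am bp bm :: "('x + 'x) multiset set"
  assumes "implication_frame X bt"
    and "ap \<in> roles X bt" and "am \<in> roles X bt"
    and "bp \<in> roles X bt" and "bm \<in> roles X bt"
  shows "qt_neg (ap, am) = is_neg (ap, am)
    \<and> qt_tensor (girard_quantale X bt) (ap, am) (bp, bm) = is_tensor X bt (ap, am) (bp, bm)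
    \<and> qt_plus (girard_quantale X bt) (ap, am) (bp, bm) = is_plus X bt (ap, am) (bp, bm)
    \<and> qt_par (girard_quantale X bt) (ap, am) (bp, bm) = is_par X bt (ap, am) (bp, bm)
    \<and> qt_with (girard_quantale X bt) (ap, am) (bp, bm) = is_with X bt (ap, am) (bp, bm)"
  using assms
  by (simp add: qt_neg_def qt_tensor_def qt_plus_def qt_par_def qt_with_def
      is_neg_def is_tensor_def is_plus_def is_par_def is_with_def
      tensor_girard_quantale q_par_girard_quantale meet_girard_quantale RSR_is_cap
      \<comment> \<open>\<open>is_cap_def\<close> is instantiated at the two joins only; unfolding
        it everywhere would destroy the pattern of \<open>RSR_is_cap\<close>.\<close>
      join_girard_quantale carrier_girard_quantale is_cap_def[of X bt ap bp]
      is_cap_def[of X bt am bm])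

end
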